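(* Let $M\ge2$ be an integer, and consider the channel with parameters $(k,M,\xi,\gamma)$ where $k=2$, $1<\xi<\infty$ and $\gamma=\infty$. Then the code $\mathcal{C}^*_{\xi,\infty}$ obtained by the greedy construction described in the context is an optimal zero-error code for this channel. That is, any two distinct elements of $\mathcal{C}^*_{\xi,\infty}$ are distinguishable, and every zero-error code $\mathcal{C}\subseteq\mathcal{X}$ satisfies $|\mathcal{C}|\le|\mathcal{C}^*_{\xi,\infty}|$.
   Context: Input vectors (for $k=2$): let $\mathcal{X}$ be the set of vectors $\mathbf{x}=(x_1,x_2)$ with $x_1,x_2\in\{1,\ldots,M\}$ and $x_1+x_2\le M$. Channel: fix real numbers $0<a<b<\infty$ (jitter interval $[a,b]$) with $\xi=b/a$, and the unbounded clock drift interval $I=[T_1,\infty)$ with $T_1>0$ (denoted $\gamma=\infty$). When $\mathbf{x}$ is sent, the output is $Y_i=TZ_ix_i$ for $i=1,2$, where $T\in I$ and $Z_1,Z_2\in[a,b]$ are arbitrary unknown reals. Two vectors $\mathbf{x},\mathbf{x}'\in\mathcal{X}$ are indistinguishable if there exist $T,T'\in I$ and $Z_1,Z_2,Z_1',Z_2'\in[a,b]$ such that $TZ_ix_i=T'Z_i'x_i'$ for $i=1,2$. Otherwise they are distinguishable. Distinguishability depends on $a,b,T_1$ only through $\xi$. A zero-error code is a set $\mathcal{C}\subseteq\mathcal{X}$ any two distinct elements of which are distinguishable. An optimal zero-error code is a zero-error code of maximum cardinality. Construction of $\mathcal{C}^*_{\xi,\infty}$: let $\mathcal{U}=\{x_2/x_1:\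 (x_1,x_2)\in\mathcal{X},\ \gcd(x_1,x_2)=1\}$. This is a finite set of positive rationals, and each $u\in\mathcal{U}$ equals $x_2/x_1$ for exactly one $(x_1,x_2)\in\mathcal{X}$ with $\gcd(x_1,x_2)=1$. (1) Start with $\mathcal{C}^*_{\xi,\infty}=\{(M-1,1)\}$ and $u_1=\frac{1}{M-1}$, the smallest element of $\mathcal{U}$. (2) Given $u_{i-1}$, consider $\mathcal{U}\cap(\xi^2u_{i-1},\infty)$. If it is empty, stop. Otherwise let $u_i$ be its smallest element, add to $\mathcal{C}^*_{\xi,\infty}$ the unique $(x_1,x_2)\in\mathcal{X}$ with $\gcd(x_1,x_2)=1$ and $x_2/x_1=u_i$, and repeat step (2). *)

theory Defs
  imports Complex_Main
begin

definition inputs :: "nat \<Rightarrow> (nat \<times> nat) set" where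
  "inputs M = {(x1, x2). x1 \<in> {1..M} \<and> x2 \<in> {1..M} \<and> x1 + x2 \<le> M}"

text \<open>
  The channel has jitter interval \<open>[a, b]\<close> and clock drift interval \<open>[T1, \<infinity>)\<close>.
\<close>

definition indistinguishable ::
  "real \<Rightarrow> real \<Rightarrow> real \<Rightarrow> nat \<times> nat \<Rightarrow> nat \<times> nat \<Rightarrow> bool" where
  "indistinguishable a b T1 x x' \<longleftrightarrow>
    (\<exists>T\<in>{T1..}. \<exists>T'\<in>{T1..}.
      \<exists>z1\<in>{a..b}. \<exists>z2\<in>{a..b}. \<exists>z1'\<in>{a..b}. \<exists>z2'\<in>{a..b}.
        T * z1 * real (fst x) = T' * z1' * real (fst x') \<and>
        T * z2 * real (snd x) = T' * z2' * real (snd x'))"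

definition distinguishable ::
  "real \<Rightarrow> real \<Rightarrow> real \<Rightarrow> nat \<times> nat \<Rightarrow> nat \<times> nat \<Rightarrow> bool" where
  "distinguishable a b T1 x x' \<longleftrightarrow> \<not> indistinguishable a b T1 x x'"

definition zero_error_code ::
  "nat \<Rightarrow> real \<Rightarrow> real \<Rightarrow> real \<Rightarrow> (nat \<times> nat) set \<Rightarrow> bool" where
  "zero_error_code M a b T1 C \<longleftrightarrow>
    C \<subseteq> inputs M \<and> (\<forall>x\<in>C. \<forall>x'\<in>C. x \<noteq> x' \<longrightarrow> distinguishable a b T1 x x')"

definition optimal_zero_error_code ::
  "nat \<Rightarrow> real \<Rightarrow> real \<Rightarrow> real \<Rightarrow> (nat \<times> nat) set \<Rightarrow> bool" where
  "optimal_zero_error_code M a b T1 C \<longleftrightarrow>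
    zero_error_code M a b T1 C \<and>
    (\<forall>C'. zero_error_code M a b T1 C' \<longrightarrow> card C' \<le> card C)"

definition ratio :: "nat \<times> nat \<Rightarrow> real" where
  "ratio x = real (snd x) / real (fst x)"

definition primitive_inputs :: "nat \<Rightarrow> (nat \<times> nat) set" where
  "primitive_inputs M = {x \<in> inputs M. gcd (fst x) (snd x) = 1}"

definition ratios :: "nat \<Rightarrow> real set" where
  "ratios M = ratio ` primitive_inputs M"

text \<open>
  The greedy construction as the set of all vectors it ever adds. Since \<open>ratio\<close> is injective
  on \<open>primitive_inputs M\<close>, each codeword \<open>x\<close> has at most one successor \<open>y\<close> under
  rule \<open>step\<close>, and none once no ratio exceeds \<open>\<xi>\<^sup>2 * ratio x\<close>. The nonemptiness premise is
  needed because \<open>Min {}\<close> is unspecified.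
\<close>

inductive_set greedy_code :: "nat \<Rightarrow> real \<Rightarrow> (nat \<times> nat) set"
  for M :: nat and \<xi> :: real where
  start: "(M - 1, 1) \<in> greedy_code M \<xi>"
| step: "\<lbrakk>x \<in> greedy_code M \<xi>;
     ratios M \<inter> {\<xi>\<^sup>2 * ratio x <..} \<noteq> {};
     y \<in> primitive_inputs M;
     ratio y = Min (ratios M \<inter> {\<xi>\<^sup>2 * ratio x <..})\<rbrakk>
   \<Longrightarrow> y \<in> greedy_code M \<xi>"

end

theory Submission
  imports Defs
begin

text \<open>
  Two inputs are indistinguishable iff their ratios differ by a factor of at most \<open>\<xi>\<^sup>2\<close>: the
  unbounded drift absorbs any common scaling, and the jitters change the ratio by at most
  \<open>\<xi>\<^sup>2\<close>. Hence a zero-error code is a set of inputs whose ratios are pairwise more than a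
  factor \<open>\<xi>\<^sup>2\<close> apart. Sending each codeword of an arbitrary code to the greedy codeword of
  largest ratio not above its own is injective: between two codewords with the same image,
  the greedy construction would have added another codeword.
\<close>

section \<open>Indistinguishability in terms of ratios\<close>

lemma inputsD:
  assumes "x \<in> inputs M"
  shows "0 < fst x" "0 < snd x" "fst x + snd x \<le> M"
  using assms by (auto simp: inputs_def)

lemma finite_inputs: "finite (inputs M)"
  by (rule finite_subset[of _ "{1..M} \<times> {1..M}"]) (auto simp: inputs_def)

lemma ratio_pos: "x \<in> inputs M \<Longrightarrow> 0 < ratio x"
  using inputsD[of x M] by (simp add: ratio_def)

lemma indistinguishable_sym:
  "indistinguishable a b T1 x y \<Longrightarrow> indistinguishable a b T1 y x"
  unfolding indistinguishable_def
  apply (elim bexE conjE)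
  subgoal for T T' z1 z2 z1' z2'
    by (rule bexI[of _ T'], rule bexI[of _ T], rule bexI[of _ z1'], rule bexI[of _ z2'],
        rule bexI[of _ z1], rule bexI[of _ z2]) simp_all
  done

text \<open>Dividing the second channel equation by the first cancels both drifts. What remains is a
  product of two jitter quotients, each at most \<open>b / a\<close>.\<close>

lemma indistinguishable_imp_ratio_le:
  assumes "x \<in> inputs M" "y \<in> inputs M" "0 < a" "0 < T1"
    and "indistinguishable a b T1 x y"
  shows "ratio y \<le> (b / a)\<^sup>2 * ratio x"
proof -
  obtain T T' z1 z2 w1 w2 where
    T: "T \<ge> T1" "T' \<ge> T1" and
    z: "z1 \<in> {a..b}" "z2 \<in> {a..b}" "w1 \<in> {a..b}" "w2 \<in> {a..b}" and
    eq: "T * z1 * real (fst x) = T' * w1 * real (fst y)"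
        "T * z2 * real (snd x) = T' * w2 * real (snd y)"
    using assms(5) unfolding indistinguishable_def by auto
  have pos: "0 < real (fst x)" "0 < real (snd x)" "0 < real (fst y)" "0 < real (snd y)"
    using assms(1,2) by (auto dest: inputsD)
  have T0: "0 < T" "0 < T'" and z0: "0 < z1" "0 < z2" "0 < w1" "0 < w2"
    using T z assms(3,4) by auto
  have "ratio y = (T * z2 * real (snd x) / (T' * w2)) / (T * z1 * real (fst x) / (T' * w1))"
    using T0 z0 by (simp add: eq ratio_def)
  also have "\<dots> = (z2 / w2) * (w1 / z1) * ratio x"
    using T0 z0 pos by (simp add: ratio_def field_simps)
  also have "\<dots> \<le> (b / a) * (b / a) * ratio x"
    using z z0 assms(3) ratio_pos[OF assms(1)]
    by (intro mult_right_mono mult_mono frac_le) auto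
  finally show ?thesis
    by (simp add: power2_eq_square)
qed

text \<open>The jitters only have to account for the quotient of the two ratios; the freely chosen
  drifts absorb the remaining common scale.\<close>

lemma indistinguishable_if_ratio_le:
  assumes "x \<in> inputs M" "y \<in> inputs M" "0 < a" "a < b" "0 < T1"
    and "ratio x \<le> ratio y" "ratio y \<le> (b / a)\<^sup>2 * ratio x"
  shows "indistinguishable a b T1 x y"
proof -
  have rpos: "0 < ratio x" "0 < ratio y"
    using assms(1,2) by (auto intro: ratio_pos)
  have pos: "1 \<le> real (fst x)" "1 \<le> real (snd x)" "1 \<le> real (fst y)" "1 \<le> real (snd y)"
    using inputsD[OF assms(1)] inputsD[OF assms(2)] by auto
  \<comment> \<open>The square root splits the quotient evenly between the two coordinates, so the
    jitters \<open>a\<close> and \<open>a * s\<close> suffice and both stay in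
    \<open>{a..b}\<close>.\<close>
  define s where "s = sqrt (ratio y / ratio x)"
  have s1: "1 \<le> s"
    unfolding s_def using rpos assms(6) by simp
  have "ratio y / ratio x \<le> (b / a)\<^sup>2"
    using rpos assms(7) by (simp add: pos_divide_le_eq)
  then have "s \<le> b / a"
    unfolding s_def using assms(3,4) by (intro real_le_lsqrt) auto
  then have sb: "a * s \<le> b"
    using assms(3,4) by (simp add: field_simps)
  have "s\<^sup>2 = ratio y / ratio x"
    unfolding s_def using rpos by simp
  then have s2: "s * s * real (snd x) * real (fst y) = real (snd y) * real (fst x)"
    using pos by (simp add: ratio_def power2_eq_square field_simps)
  \<comment> \<open>The first channel equation forces \<open>T\<close> and \<open>T'\<close> into
    the proportion \<open>s * fst y\<close> to \<open>fst x\<close>. Both numbers are at least 1, so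
    the factor \<open>T1\<close> lifts both drifts to at least \<open>T1\<close>; no upper limit on
    the drift has to be met.\<close>
  define T where "T = T1 * (s * real (fst y))"
  define T' where "T' = T1 * real (fst x)"
  have "1 * 1 \<le> s * real (fst y)"
    using s1 pos by (intro mult_mono) auto
  then have "T \<in> {T1..}" "T' \<in> {T1..}"
    unfolding T_def T'_def using assms(5) pos by simp_all
  moreover have "a \<in> {a..b}" "a * s \<in> {a..b}"
    using s1 sb assms(3,4) by auto
  moreover have "T * a * real (fst x) = T' * (a * s) * real (fst y)"
    by (simp add: T_def T'_def)
  moreover have "T * (a * s) * real (snd x) = T' * a * real (snd y)"
  proof -
    have "T * (a * s) * real (snd x) = T1 * a * (s * s * real (snd x) * real (fst y))"
      by (simp add: T_def)
    also have "\<dots> = T' * a * real (snd y)"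
      unfolding s2 by (simp add: T'_def)
    finally show ?thesis .
  qed
  ultimately show ?thesis
    unfolding indistinguishable_def by blast
qed

lemma distinguishable_iff_ratio:
  assumes "x \<in> inputs M" "y \<in> inputs M" "0 < a" "a < b" "0 < T1"
  shows "distinguishable a b T1 x y \<longleftrightarrow>
    (b / a)\<^sup>2 * ratio x < ratio y \<or> (b / a)\<^sup>2 * ratio y < ratio x"
proof -
  have "indistinguishable a b T1 x y \<longleftrightarrow>
      ratio y \<le> (b / a)\<^sup>2 * ratio x \<and> ratio x \<le> (b / a)\<^sup>2 * ratio y"
    (is "?ind \<longleftrightarrow> ?near")
  proof
    assume ?ind
    with assms show ?near
      by (blast intro: indistinguishable_imp_ratio_le indistinguishable_sym)
  next
    assume ?near
    with assms show ?ind
      \<comment> \<open>The witnesses were built with the smaller ratio first; symmetry covers the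
        other order.\<close>
      by (cases "ratio x \<le> ratio y")
        (simp_all add: indistinguishable_if_ratio_le
          indistinguishable_sym[OF indistinguishable_if_ratio_le])
  qed
  then show ?thesis
    by (auto simp: distinguishable_def)
qed

section \<open>Ratios and primitive vectors\<close>

lemma inj_on_ratio: "inj_on ratio (primitive_inputs M)"
proof (rule inj_onI)
  fix x y
  assume x: "x \<in> primitive_inputs M" and y: "y \<in> primitive_inputs M"
    and eq: "ratio x = ratio y"
  have pos: "0 < fst x" "0 < fst y"
    and cop: "coprime (fst x) (snd x)" "coprime (fst y) (snd y)"
    using x y by (auto simp: primitive_inputs_def coprime_iff_gcd_eq_1 dest: inputsD)
  have "real (fst x * snd y) = real (fst y * snd x)"
    using eq pos by (simp add: ratio_def field_simps)
  then have "fst x * snd y = fst y * snd x"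
    by (simp only: of_nat_eq_iff)
  \<comment> \<open>Uniqueness of reduced fractions.\<close>
  then have "fst x = fst y \<and> snd x = snd y"
    using coprime_crossproduct_nat[of "fst x" "snd x" "fst y" "snd y"] cop
    by (simp add: mult.commute coprime_commute[of "fst y"])
  then show "x = y"
    by (simp add: prod_eq_iff)
qed

lemma finite_ratios: "finite (ratios M)"
  unfolding ratios_def primitive_inputs_def using finite_inputs by simp

text \<open>Dividing by the gcd does not increase the coordinates, so the reduced vector is still an
  input. This lets codewords that are not primitive be compared with the greedy choices.\<close>

lemma ratio_in_ratios:
  assumes "x \<in> inputs M"
  shows "ratio x \<in> ratios M"
proof -
  define g where "g = gcd (fst x) (snd x)"
  note pos = inputsD[OF assms]
  have g: "0 < g" "g dvd fst x" "g dvd snd x"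
    using pos by (auto simp: g_def)
  then obtain p q where pq: "fst x = g * p" "snd x = g * q"
    by (auto elim!: dvdE)
  have "p \<le> fst x" "q \<le> snd x"
    using g(1) by (simp_all add: pq)
  moreover have "0 < p" "0 < q"
    using pos(1,2) by (simp_all add: pq)
  ultimately have "(p, q) \<in> inputs M"
    using pos(3) unfolding inputs_def by simp
  moreover have "gcd p q = 1"
  proof -
    have "g = g * gcd p q"
      using g_def by (simp add: pq gcd_mult_distrib_nat)
    then show ?thesis using g(1) by simp
  qed
  ultimately have "(p, q) \<in> primitive_inputs M"
    by (simp add: primitive_inputs_def)
  moreover have "ratio x = ratio (p, q)"
    using g(1) by (simp add: ratio_def pq)
  ultimately show ?thesis
    unfolding ratios_def by blast
qed

section \<open>The greedy construction\<close>

lemma start_primitive: "M \<ge> 2 \<Longrightarrow> (M - 1, 1) \<in> primitive_inputs M"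
  unfolding primitive_inputs_def inputs_def by auto

text \<open>This guarantees that every input has some greedy codeword at or below it.\<close>

lemma ratio_start_le:
  assumes "x \<in> inputs M"
  shows "ratio (M - 1, 1) \<le> ratio x"
proof -
  have "1 / real (M - 1) \<le> real (snd x) / real (fst x)"
    using inputsD[OF assms] by (intro frac_le) auto
  then show ?thesis by (simp add: ratio_def)
qed

lemma greedy_code_primitive:
  "x \<in> greedy_code M \<xi> \<Longrightarrow> M \<ge> 2 \<Longrightarrow> x \<in> primitive_inputs M"
  by (induction rule: greedy_code.induct) (auto simp del: One_nat_def intro: start_primitive)

lemma greedy_code_inputs:
  "x \<in> greedy_code M \<xi> \<Longrightarrow> M \<ge> 2 \<Longrightarrow> x \<in> inputs M"
  using greedy_code_primitive by (auto simp: primitive_inputs_def)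

lemma finite_greedy_code: "M \<ge> 2 \<Longrightarrow> finite (greedy_code M \<xi>)"
  using finite_subset[OF _ finite_inputs] greedy_code_inputs by (metis subsetI)

text \<open>Minimality is spelled out by inequalities, so that the separation argument can use
  linear order reasoning instead of \<open>Min\<close>.\<close>

definition greedy_step :: "nat \<Rightarrow> real \<Rightarrow> real \<Rightarrow> real \<Rightarrow> bool" where
  "greedy_step M \<xi> r s \<longleftrightarrow> s \<in> ratios M \<and> \<xi>\<^sup>2 * r < s \<and> (\<forall>t\<in>ratios M. \<xi>\<^sup>2 * r < t \<longrightarrow> s \<le> t)"

lemma greedy_step_Min:
  assumes "ratios M \<inter> {\<xi>\<^sup>2 * r <..} \<noteq> {}"
  shows "greedy_step M \<xi> r (Min (ratios M \<inter> {\<xi>\<^sup>2 * r <..}))"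
  using Min_in[OF _ assms] finite_ratios
  by (auto simp: greedy_step_def)

text \<open>The construction cannot stop at \<open>x\<close> while an input lies beyond the gap, and
  its next choice, being least, cannot overshoot that input.\<close>

lemma greedy_code_successor:
  assumes "x \<in> greedy_code M \<xi>" "y \<in> inputs M" "\<xi>\<^sup>2 * ratio x < ratio y"
  obtains z where "z \<in> greedy_code M \<xi>" "\<xi>\<^sup>2 * ratio x < ratio z" "ratio z \<le> ratio y"
proof -
  let ?S = "ratios M \<inter> {\<xi>\<^sup>2 * ratio x <..}"
  have ne: "?S \<noteq> {}"
    using ratio_in_ratios[OF assms(2)] assms(3) by auto
  have st: "greedy_step M \<xi> (ratio x) (Min ?S)"
    using greedy_step_Min[OF ne] .
  then obtain z where z: "z \<in> primitive_inputs M" "ratio z = Min ?S"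
    unfolding greedy_step_def ratios_def by auto
  then have "z \<in> greedy_code M \<xi>"
    using greedy_code.step[OF assms(1) ne] by blast
  then show ?thesis
    using that st z(2) ratio_in_ratios[OF assms(2)] assms(3) unfolding greedy_step_def by metis
qed

lemma greedy_code_induct [consumes 1, case_names start step]:
  assumes "x \<in> greedy_code M \<xi>" "P (M - 1, 1)"
    and "\<And>x y. x \<in> greedy_code M \<xi> \<Longrightarrow> P x \<Longrightarrow> y \<in> greedy_code M \<xi> \<Longrightarrow>
      greedy_step M \<xi> (ratio x) (ratio y) \<Longrightarrow> P y"
  shows "P x"
  using assms(1)
proof (induction rule: greedy_code.induct)
  case (step x y)
  have "greedy_step M \<xi> (ratio x) (ratio y)"
    using greedy_step_Min[OF step.hyps(2)] by (simp only: step.hyps(4))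
  then show ?case
    using assms(3)[OF step.hyps(1) step.IH] greedy_code.step[OF step.hyps] by blast
qed (fact assms(2))

text \<open>The code carries no enumeration to compare indices in, so two codewords are compared by
  nested induction on how each was generated. Equality of ratios becomes equality of vectors later,
  by injectivity.\<close>

lemma greedy_code_separated:
  assumes "M \<ge> 2" "1 \<le> \<xi>" "x \<in> greedy_code M \<xi>" "y \<in> greedy_code M \<xi>"
  shows "ratio x = ratio y \<or> \<xi>\<^sup>2 * ratio x < ratio y \<or> \<xi>\<^sup>2 * ratio y < ratio x"
proof -
  have in_ratios: "ratio z \<in> ratios M" if "z \<in> greedy_code M \<xi>" for z
    using that assms(1) by (intro ratio_in_ratios greedy_code_inputs)
  have start_le: "ratio (M - 1, 1) \<le> ratio z" if "z \<in> greedy_code M \<xi>" for z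
    using that assms(1) by (intro ratio_start_le greedy_code_inputs)
  have mono: "\<xi>\<^sup>2 * r \<le> \<xi>\<^sup>2 * s" if "r \<le> s" for r s
    using that by (intro mult_left_mono) auto
  have grow: "ratio z \<le> \<xi>\<^sup>2 * ratio z" if "z \<in> greedy_code M \<xi>" for z
  proof -
    have "1 \<le> \<xi>\<^sup>2"
      using assms(2) by (simp add: one_le_power)
    then show ?thesis
      using mult_right_mono[of 1 "\<xi>\<^sup>2" "ratio z"]
        ratio_pos[OF greedy_code_inputs[OF that assms(1)]] by simp
  qed
  \<comment> \<open>A codeword other than the start succeeds some \<open>z\<close>, whose ratio is
    at least that of the start; the gap above \<open>z\<close> then clears the gap above the
    start.\<close>
  have start_sep: "ratio (M - 1, 1) = ratio z \<or> \<xi>\<^sup>2 * ratio (M - 1, 1) < ratio z"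
    if "z \<in> greedy_code M \<xi>" for z
    using that
  proof (induction rule: greedy_code_induct)
    case (step z w)
    then show ?case
      using mono[OF start_le] unfolding greedy_step_def by fastforce
  qed simp
  \<comment> \<open>The claim ranges over all \<open>y\<close> because the inner step applies the
    hypothesis for \<open>x\<close> to the successor \<open>y'\<close>.\<close>
  from assms(3) have "\<forall>y \<in> greedy_code M \<xi>.
    ratio x = ratio y \<or> \<xi>\<^sup>2 * ratio x < ratio y \<or> \<xi>\<^sup>2 * ratio y < ratio x"
  proof (induction rule: greedy_code_induct)
    case start
    then show ?case using start_sep by blast
  next
    case (step x x')
    note IH = step.IH and x = step.hyps(1) and x' = step.hyps(2) and succ = step.hyps(3)
    show ?case
    proof
      fix y assume "y \<in> greedy_code M \<xi>"
      then show "ratio x' = ratio y \<or> \<xi>\<^sup>2 * ratio x' < ratio y \<or> \<xi>\<^sup>2 * ratio y < ratio x'"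
      proof (induction rule: greedy_code_induct)
        case start
        then show ?case using start_sep[OF x'] by auto
      next
        case (step y y')
        have le: "\<xi>\<^sup>2 * ratio x < ratio x'"
            "\<xi>\<^sup>2 * ratio x < ratio y' \<Longrightarrow> ratio x' \<le> ratio y'"
          using succ in_ratios[OF step.hyps(2)] unfolding greedy_step_def by auto
        have ge: "\<xi>\<^sup>2 * ratio y < ratio y'"
            "\<xi>\<^sup>2 * ratio y < ratio x' \<Longrightarrow> ratio y' \<le> ratio x'"
          using step.hyps(3) in_ratios[OF x'] unfolding greedy_step_def by auto
        have "ratio x = ratio y' \<or> \<xi>\<^sup>2 * ratio x < ratio y' \<or> \<xi>\<^sup>2 * ratio y' < ratio x"
          using IH step.hyps(2) by blast
        \<comment> \<open>If \<open>x'\<close> lies beyond the gap above \<open>y\<close> and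
          \<open>y'\<close> beyond the gap above \<open>x\<close>, minimality of both successors
          forces equal ratios. In every other case one of \<open>x'\<close>, \<open>y'\<close> is at
          or below the predecessor of the other, and the gap follows.\<close>
        then show ?case
          using step.IH le ge grow[OF x] grow[OF step.hyps(1)] by auto
      qed
    qed
  qed
  then show ?thesis using assms(4) by blast
qed

section \<open>Optimality of the greedy code\<close>

lemma greedy_code_zero_error:
  assumes "M \<ge> 2" "0 < a" "a < b" "0 < T1"
  shows "zero_error_code M a b T1 (greedy_code M (b / a))"
  unfolding zero_error_code_def
proof (intro conjI ballI impI subsetI)
  fix x y
  assume xy: "x \<in> greedy_code M (b / a)" "y \<in> greedy_code M (b / a)" "x \<noteq> y"
  then have "ratio x \<noteq> ratio y"
    using inj_on_ratio greedy_code_primitive assms(1) by (meson inj_onD)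
  then show "distinguishable a b T1 x y"
    using greedy_code_separated[of M "b / a" x y] xy assms
    by (simp add: distinguishable_iff_ratio[of x M y] greedy_code_inputs)
qed (use assms greedy_code_inputs in blast)

lemma card_zero_error_code_le:
  assumes "M \<ge> 2" "0 < a" "a < b" "0 < T1" and code: "zero_error_code M a b T1 C"
  shows "card C \<le> card (greedy_code M (b / a))"
proof -
  define G where "G = greedy_code M (b / a)"
  have C: "C \<subseteq> inputs M"
    using code by (simp add: zero_error_code_def)
  have finG: "finite G"
    using finite_greedy_code assms(1) by (simp add: G_def)
  \<comment> \<open>The maximum exists because the candidates are finite in number and include the
    starting vector.\<close>
  have "\<exists>y\<in>G. ratio y \<le> ratio x \<and> (\<forall>z\<in>G. ratio z \<le> ratio x \<longrightarrow> ratio z \<le> ratio y)"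
    if "x \<in> C" for x
  proof -
    let ?B = "{y \<in> G. ratio y \<le> ratio x}"
    have "(M - 1, 1) \<in> ?B"
      unfolding G_def using greedy_code.start ratio_start_le that C by blast
    then have ne: "ratio ` ?B \<noteq> {}" by blast
    have fin: "finite (ratio ` ?B)" using finG by simp
    obtain y where y: "y \<in> ?B" "ratio y = Max (ratio ` ?B)"
      using Max_in[OF fin ne] by auto
    have "ratio z \<le> ratio y" if "z \<in> ?B" for z
      using Max_ge[OF fin, of "ratio z"] that y(2) by simp
    then show ?thesis using y(1) by blast
  qed
  then obtain f where f: "\<And>x. x \<in> C \<Longrightarrow> f x \<in> G" "\<And>x. x \<in> C \<Longrightarrow> ratio (f x) \<le> ratio x"
      "\<And>x z. x \<in> C \<Longrightarrow> z \<in> G \<Longrightarrow> ratio z \<le> ratio x \<Longrightarrow> ratio z \<le> ratio (f x)"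
    by metis
  have no_jump: "\<not> (b / a)\<^sup>2 * ratio x < ratio y"
    if xy: "x \<in> C" "y \<in> C" "f x = f y" for x y
  proof
    assume "(b / a)\<^sup>2 * ratio x < ratio y"
    moreover have "(b / a)\<^sup>2 * ratio (f x) \<le> (b / a)\<^sup>2 * ratio x"
      using f(2)[OF xy(1)] by (intro mult_left_mono) auto
    ultimately have jump: "(b / a)\<^sup>2 * ratio (f x) < ratio y"
      by linarith
    have "f x \<in> greedy_code M (b / a)" "y \<in> inputs M"
      using f(1) xy C by (auto simp: G_def)
    from greedy_code_successor[OF this jump] obtain z where
      z: "z \<in> G" "(b / a)\<^sup>2 * ratio (f x) < ratio z" "ratio z \<le> ratio y"
      unfolding G_def by blast
    \<comment> \<open>Maximality is applied at \<open>y\<close>, not at \<open>x\<close>: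
      \<open>z\<close> is a greedy codeword at or below \<open>y\<close>, and \<open>f y\<close> is
      \<open>f x\<close>. Yet \<open>z\<close> was chosen strictly above \<open>f x\<close>.\<close>
    have "ratio z \<le> ratio (f x)"
      using f(3)[OF xy(2) z(1,3)] xy(3) by simp
    moreover have "0 < ratio (f x)"
      using f(1)[OF xy(1)] greedy_code_inputs assms(1) ratio_pos unfolding G_def by blast
    then have "ratio (f x) \<le> (b / a)\<^sup>2 * ratio (f x)"
      using mult_right_mono[of 1 "(b / a)\<^sup>2" "ratio (f x)"] assms(2,3)
      by (simp add: one_le_power)
    ultimately show False using z(2) by simp
  qed
  have "inj_on f C"
  proof (rule inj_onI, rule ccontr)
    fix x y assume xy: "x \<in> C" "y \<in> C" "f x = f y" "x \<noteq> y"
    then have "distinguishable a b T1 x y"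
      using code by (simp add: zero_error_code_def)
    \<comment> \<open>Distinguishability gives a jump in one of the two directions, so
      \<open>no_jump\<close> is used in both orders.\<close>
    then show False
      using distinguishable_iff_ratio[of x M y a b T1] xy C assms(2-4)
        no_jump[of x y] no_jump[of y x] by auto
  qed
  then show ?thesis
    using card_inj_on_le[of f C G] f(1) finG unfolding G_def by blast
qed

theorem theorem4:
  fixes M :: nat and a b T1 \<xi> :: real
  assumes "M \<ge> 2"
    and "0 < a" and "a < b" and "\<xi> = b / a"
    and "0 < T1"
  shows "optimal_zero_error_code M a b T1 (greedy_code M \<xi>)"
  unfolding optimal_zero_error_code_def
  using assms greedy_code_zero_error card_zero_error_code_le by blast

end
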